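(* Let $X$ be a real Banach space, $C\subset X$ a nonempty closed bounded convex set, $f:X\to\mathbb{R}$ a convex, continuously Fréchet differentiable function, and $g:X\to(-\infty,\infty]$ a proper, lower semicontinuous, convex function with $C\subset\{x\in X:g(x)<\infty\}$. Put $\varphi=f+g$ and assume that $\varphi$ attains its minimum over $C$. Let $\{x_k\}_{k\ge0}$ be a sequence generated by the generalized Frank-Wolfe algorithm from an arbitrary $x_0\in C$ (the subproblem defining $\bar x_k$ being solvable for each $k$). Assume: (i) the Fréchet derivative $f'$ is uniformly continuous on $C$; (ii) the stepsizes $\{\gamma_k\}\subset(0,1]$ satisfy $\lim_{k\to\infty}\gamma_k=0$ and $\sum_{k=0}^\infty\gamma_k=\infty$. Then $\lim_{k\to\infty}\varphi(x_k)=\varphi^*:=\inf_{x\in C}\varphi(x)$.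
   Context: $\langle\cdot,\cdot\rangle$ is the pairing between the dual $X^*$ and $X$. Generalized Frank-Wolfe algorithm for $\min_{x\in C}\varphi(x)=f(x)+g(x)$: given $x_0\in C$, for each $k\ge0$ choose $\bar x_k\in C$ to be a minimizer of $x\mapsto\langle f'(x_k),x\rangle+g(x)$ over $C$, and set $x_{k+1}=x_k+\gamma_k(\bar x_k-x_k)$, where $\gamma_k$ is the stepsize. *)

theory Defs
  imports "HOL-Analysis.Analysis"
begin

definition proper_fun :: "('a \<Rightarrow> ereal) \<Rightarrow> bool" where
  "proper_fun g \<longleftrightarrow> (\<forall>x. g x \<noteq> -\<infinity>) \<and> (\<exists>x. g x \<noteq> \<infinity>)"

definition lsc_fun :: "('a::topological_space \<Rightarrow> ereal) \<Rightarrow> bool" where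
  "lsc_fun g \<longleftrightarrow> (\<forall>x. g x \<le> Liminf (at x) g)"

text \<open>In \<^typ>\<open>ereal\<close> we have \<^prop>\<open>0 * (\<infinity>::ereal) = 0\<close>, so the degenerate weights are
  harmless. The notion is meant for functions that never take the value \<open>-\<infinity>\<close>.\<close>

definition convex_fun :: "('a::real_vector \<Rightarrow> ereal) \<Rightarrow> bool" where
  "convex_fun g \<longleftrightarrow> (\<forall>x y. \<forall>u\<ge>0. \<forall>v\<ge>0. u + v = 1 \<longrightarrow>
     g (u *\<^sub>R x + v *\<^sub>R y) \<le> ereal u * g x + ereal v * g y)"

text \<open>\<open>f'\<close> is the derivative of the smooth part as a map into the dual space
  \<^typ>\<open>'a::real_normed_vector \<Rightarrow>\<^sub>L real\<close>, and \<open>xb\<close> is the sequence of chosen subproblem minimizers.\<close>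

definition generalized_frank_wolfe ::
  "'a::real_normed_vector set \<Rightarrow> ('a \<Rightarrow> 'a \<Rightarrow>\<^sub>L real) \<Rightarrow> ('a \<Rightarrow> ereal) \<Rightarrow> (nat \<Rightarrow> real)
    \<Rightarrow> (nat \<Rightarrow> 'a) \<Rightarrow> (nat \<Rightarrow> 'a) \<Rightarrow> bool" where
  "generalized_frank_wolfe C f' g \<gamma> x xb \<longleftrightarrow>
     x 0 \<in> C \<and>
     (\<forall>k. is_arg_min (\<lambda>y. ereal (blinfun_apply (f' (x k)) y) + g y) (\<lambda>y. y \<in> C) (xb k) \<and>
          x (Suc k) = x k + \<gamma> k *\<^sub>R (xb k - x k))"

end

theory Submission
  imports Defs
begin

text \<open>
  Moving from \<open>x\<^sub>k\<close> the fraction \<open>\<gamma>\<^sub>k\<close> of the way to \<open>xb\<^sub>k\<close> decreases \<open>\<phi>\<close> by at least \<open>\<gamma>\<^sub>k\<close> times the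
  Frank-Wolfe gap \<open>f' x\<^sub>k (x\<^sub>k - xb\<^sub>k) + g x\<^sub>k - g xb\<^sub>k\<close>, up to the linearization error of \<open>f\<close>. The gap dominates
  \<open>\<phi> x\<^sub>k - \<phi> z\<close> for every \<open>z\<close> in \<open>C\<close>, by the gradient inequality and the choice of \<open>xb\<^sub>k\<close>. The error is
  \<open>o(\<gamma>\<^sub>k)\<close>, because \<open>f'\<close> is uniformly continuous and the steps shrink. Hence, for every \<open>\<epsilon> > 0\<close> and all
  large \<open>k\<close>, \<open>\<phi> x\<^sub>k\<^sub>+\<^sub>1 \<le> (1 - \<gamma>\<^sub>k) \<phi> x\<^sub>k + \<gamma>\<^sub>k (\<phi> z + \<epsilon>)\<close>. As the products of the factors \<open>1 - \<gamma>\<^sub>k\<close>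
  tend to zero, the values \<open>\<phi> x\<^sub>k\<close> eventually drop below \<open>\<phi> z + 2 \<epsilon>\<close>.
\<close>

lemma convex_on_imp_above_tangent_frechet:
  fixes f :: "'a::real_normed_vector \<Rightarrow> real"
  assumes "convex_on S f" and "(f has_derivative f') (at a within S)" and "a \<in> S" and "b \<in> S"
  shows "f' (b - a) \<le> f b - f a"
proof -
  define p where "p t = a + t *\<^sub>R (b - a)" for t :: real
  have p_convex: "p t = (1 - t) *\<^sub>R a + t *\<^sub>R b" for t
    by (simp add: p_def algebra_simps)
  have "p ` {0..1} \<subseteq> S"
    using convexD_alt[OF convex_on_imp_convex[OF assms(1)] assms(3,4)] by (auto simp: p_convex)
  then have "(f has_derivative f') (at (p 0) within p ` {0..1})"
    using assms(2) by (auto simp: p_def intro: has_derivative_subset)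
  moreover have "(p has_derivative (\<lambda>t. t *\<^sub>R (b - a))) (at 0 within {0..1})"
    unfolding p_def by (auto intro!: derivative_eq_intros)
  ultimately have "((\<lambda>t. f (p t)) has_derivative (\<lambda>t. f' (t *\<^sub>R (b - a)))) (at 0 within {0..1})"
    by (rule has_derivative_in_compose[rotated])
  moreover have "f' (t *\<^sub>R (b - a)) = f' (b - a) * t" for t
    using has_derivative_linear[OF assms(2)] by (simp add: linear_scale)
  ultimately have quotient_tendsto:
      "((\<lambda>t. (f (p t) - f a) / t) \<longlongrightarrow> f' (b - a)) (at 0 within {0..1})"
    by (simp add: has_field_derivative_def[symmetric] has_field_derivative_iff p_def)
  have quotient_le: "(f (p t) - f a) / t \<le> f b - f a" if "0 < t" "t \<le> 1" for t
  proof -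
    have "f (p t) \<le> (1 - t) * f a + t * f b"
      using convex_onD[OF assms(1), of t a b] assms(3,4) that by (simp add: p_convex)
    with that show ?thesis
      by (simp add: field_simps)
  qed
  have "\<forall>\<^sub>F t in at 0 within {0..1}. (f (p t) - f a) / t \<le> f b - f a"
    by (auto simp: eventually_at_filter intro!: always_eventually quotient_le)
  with quotient_tendsto show ?thesis
    by (rule tendsto_upperbound) (simp add: trivial_limit_within islimpt_Icc)
qed

lemma uniformly_continuous_derivative_linearization:
  fixes f :: "'a::real_normed_vector \<Rightarrow> 'b::real_normed_vector" and f' :: "'a \<Rightarrow> 'a \<Rightarrow>\<^sub>L 'b"
  assumes "convex S" and "uniformly_continuous_on S f'"
    and deriv: "\<And>z. z \<in> S \<Longrightarrow> (f has_derivative f' z) (at z within S)"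
    and "0 < \<epsilon>"
  obtains \<delta> where "0 < \<delta>"
    and "\<And>a b. \<lbrakk>a \<in> S; b \<in> S; dist a b < \<delta>\<rbrakk> \<Longrightarrow>
      norm (f b - f a - f' a (b - a)) \<le> \<epsilon> * norm (b - a)"
proof -
  obtain \<delta> where "0 < \<delta>"
    and modulus: "\<And>a z. \<lbrakk>a \<in> S; z \<in> S; dist z a < \<delta>\<rbrakk> \<Longrightarrow> dist (f' z) (f' a) < \<epsilon>"
    using assms(2) \<open>0 < \<epsilon>\<close> unfolding uniformly_continuous_on_def by metis
  have "norm (f b - f a - f' a (b - a)) \<le> \<epsilon> * norm (b - a)"
    if "a \<in> S" "b \<in> S" "dist a b < \<delta>" for a b
  proof -
    define T where "T = S \<inter> ball a \<delta>"
    have "convex T" and "a \<in> T" and "b \<in> T"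
      using \<open>convex S\<close> that \<open>0 < \<delta>\<close> by (auto simp: T_def convex_Int)
    have segment: "a + t *\<^sub>R (b - a) \<in> T" if "t \<in> {0..1}" for t
      using convexD_alt[OF \<open>convex T\<close> \<open>a \<in> T\<close> \<open>b \<in> T\<close>, of t] that by (simp add: algebra_simps)
    have derivative_close: "onorm (blinfun_apply (f' z) - blinfun_apply (f' a)) \<le> \<epsilon>"
      if "z \<in> T" for z
    proof -
      have "onorm (blinfun_apply (f' z) - blinfun_apply (f' a)) = dist (f' z) (f' a)"
        by (simp add: dist_norm norm_blinfun.rep_eq minus_blinfun.rep_eq fun_diff_def)
      also have "\<dots> \<le> \<epsilon>"
        using modulus[of a z] \<open>a \<in> S\<close> that by (simp add: T_def dist_commute)
      finally show ?thesis .
    qed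
    have "norm (f b - f a - f' a (b - a)) \<le> norm (b - a) * \<epsilon>"
      using segment _ derivative_close \<open>a \<in> T\<close>
      by (rule differentiable_bound_linearization)
        (auto simp: T_def intro: has_derivative_subset[OF deriv])
    then show ?thesis
      by (simp add: mult.commute)
  qed
  with \<open>0 < \<delta>\<close> show thesis
    by (rule that)
qed

lemma prod_one_minus_tendsto_zero:
  fixes \<gamma> :: "nat \<Rightarrow> real"
  assumes "\<And>k. \<gamma> k \<le> 1" and "filterlim (\<lambda>n. \<Sum>k<n. \<gamma> k) at_top sequentially"
  shows "(\<lambda>n. \<Prod>k=m..<n. 1 - \<gamma> k) \<longlonglongrightarrow> 0"
proof (rule tendsto_sandwich)
  show "\<forall>\<^sub>F n in sequentially. 0 \<le> (\<Prod>k=m..<n. 1 - \<gamma> k)"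
    using assms(1) by (auto intro!: always_eventually prod_nonneg)
  have "(\<Prod>k=m..<n. 1 - \<gamma> k) \<le> exp (- (\<Sum>k=m..<n. \<gamma> k))" for n
  proof -
    have "(\<Prod>k=m..<n. 1 - \<gamma> k) \<le> (\<Prod>k=m..<n. exp (- \<gamma> k))"
      using assms(1) exp_ge_add_one_self[of "- \<gamma> _"] by (intro prod_mono) auto
    then show ?thesis
      by (simp add: exp_sum flip: sum_negf)
  qed
  then show "\<forall>\<^sub>F n in sequentially. (\<Prod>k=m..<n. 1 - \<gamma> k) \<le> exp (- (\<Sum>k=m..<n. \<gamma> k))"
    by simp
  have "\<forall>\<^sub>F n in sequentially. (\<Sum>k<n. \<gamma> k) + - (\<Sum>k<m. \<gamma> k) = (\<Sum>k=m..<n. \<gamma> k)"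
    using eventually_ge_at_top[of m]
    by eventually_elim (simp add: sum_diff_nat_ivl flip: atLeast0LessThan)
  moreover have "filterlim (\<lambda>n. (\<Sum>k<n. \<gamma> k) + - (\<Sum>k<m. \<gamma> k)) at_top sequentially"
    by (subst add.commute) (rule filterlim_tendsto_add_at_top[OF tendsto_const assms(2)])
  ultimately have "filterlim (\<lambda>n. \<Sum>k=m..<n. \<gamma> k) at_top sequentially"
    by (simp cong: filterlim_cong)
  then have "filterlim (\<lambda>n. - (\<Sum>k=m..<n. \<gamma> k)) at_bot sequentially"
    by (simp add: filterlim_uminus_at_bot)
  then show "(\<lambda>n. exp (- (\<Sum>k=m..<n. \<gamma> k))) \<longlonglongrightarrow> 0"
    by (rule filterlim_compose[OF exp_at_bot])
qed simp

lemma affine_contraction_le: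
  fixes r \<gamma> :: "nat \<Rightarrow> real"
  assumes "\<And>k. \<gamma> k \<le> 1"
    and contraction: "\<And>k. m \<le> k \<Longrightarrow> r (Suc k) \<le> (1 - \<gamma> k) * r k + \<gamma> k * c"
    and "m \<le> n"
  shows "r n \<le> c + (\<Prod>k=m..<n. 1 - \<gamma> k) * (r m - c)"
  using \<open>m \<le> n\<close>
proof (induction n rule: dec_induct)
  case base
  show ?case by simp
next
  case (step n)
  have "r (Suc n) \<le> c + (1 - \<gamma> n) * (r n - c)"
    using contraction[OF step.hyps(1)] by (simp add: algebra_simps)
  also have "\<dots> \<le> c + (1 - \<gamma> n) * ((\<Prod>k=m..<n. 1 - \<gamma> k) * (r m - c))"
    using step.IH assms(1) by (intro add_left_mono mult_left_mono) auto
  also have "\<dots> = c + (\<Prod>k=m..<Suc n. 1 - \<gamma> k) * (r m - c)"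
    using step.hyps(1) by simp
  finally show ?case .
qed

lemma eventually_less_if_affine_contraction:
  fixes r \<gamma> :: "nat \<Rightarrow> real"
  assumes "\<And>k. \<gamma> k \<le> 1" and "filterlim (\<lambda>n. \<Sum>k<n. \<gamma> k) at_top sequentially"
    and "\<forall>\<^sub>F k in sequentially. r (Suc k) \<le> (1 - \<gamma> k) * r k + \<gamma> k * c"
    and "c < d"
  shows "\<forall>\<^sub>F n in sequentially. r n < d"
proof -
  obtain m where contraction: "\<And>k. m \<le> k \<Longrightarrow> r (Suc k) \<le> (1 - \<gamma> k) * r k + \<gamma> k * c"
    using assms(3) by (auto simp: eventually_sequentially)
  have "(\<lambda>n. c + (\<Prod>k=m..<n. 1 - \<gamma> k) * (r m - c)) \<longlonglongrightarrow> c + 0 * (r m - c)"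
    using assms(1,2) by (intro tendsto_intros prod_one_minus_tendsto_zero)
  then have "\<forall>\<^sub>F n in sequentially. c + (\<Prod>k=m..<n. 1 - \<gamma> k) * (r m - c) < d"
    using \<open>c < d\<close> by (auto dest: order_tendstoD(2))
  with eventually_ge_at_top[of m] show ?thesis
    by eventually_elim
      (use affine_contraction_le[where \<gamma> = \<gamma> and r = r, OF assms(1) contraction] in fastforce)
qed

lemma convex_on_real_of_ereal:
  fixes g :: "'a::real_vector \<Rightarrow> ereal"
  assumes "convex_fun g" and "convex S" and finite: "\<And>z. z \<in> S \<Longrightarrow> \<bar>g z\<bar> \<noteq> \<infinity>"
  shows "convex_on S (\<lambda>z. real_of_ereal (g z))"
proof (rule convex_onI)
  have g_eq: "g z = ereal (real_of_ereal (g z))" if "z \<in> S" for z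
    using finite[OF that] by (simp add: ereal_real')
  fix t :: real and a b :: 'a
  assume t: "0 < t" "t < 1" and "a \<in> S" "b \<in> S"
  then have "(1 - t) *\<^sub>R a + t *\<^sub>R b \<in> S"
    using \<open>convex S\<close> by (simp add: convexD_alt)
  moreover have "g ((1 - t) *\<^sub>R a + t *\<^sub>R b) \<le> ereal (1 - t) * g a + ereal t * g b"
    using \<open>convex_fun g\<close> t unfolding convex_fun_def by simp
  ultimately show "real_of_ereal (g ((1 - t) *\<^sub>R a + t *\<^sub>R b))
      \<le> (1 - t) * real_of_ereal (g a) + t * real_of_ereal (g b)"
    using g_eq \<open>a \<in> S\<close> \<open>b \<in> S\<close>
    by (metis ereal_less_eq(3) plus_ereal.simps(1) times_ereal.simps(1))
qed (fact \<open>convex S\<close>)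

lemma generalized_frank_wolfe_cong:
  assumes "\<And>z. z \<in> C \<Longrightarrow> g z = h z"
  shows "generalized_frank_wolfe C f' g \<gamma> x xb \<longleftrightarrow> generalized_frank_wolfe C f' h \<gamma> x xb"
  using assms by (simp add: generalized_frank_wolfe_def is_arg_min_def cong: conj_cong)

locale real_frank_wolfe =
  fixes C :: "'a::real_normed_vector set"
    and f :: "'a \<Rightarrow> real"
    and f' :: "'a \<Rightarrow> 'a \<Rightarrow>\<^sub>L real"
    and h :: "'a \<Rightarrow> real"
    and \<gamma> :: "nat \<Rightarrow> real"
    and x xb :: "nat \<Rightarrow> 'a"
  assumes bounded_C: "bounded C"
    and convex_f: "convex_on C f"
    and convex_h: "convex_on C h"
    and derivative: "\<And>z. z \<in> C \<Longrightarrow> (f has_derivative f' z) (at z within C)"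
    and uniformly_continuous_derivative: "uniformly_continuous_on C f'"
    and iteration: "generalized_frank_wolfe C f' (\<lambda>z. ereal (h z)) \<gamma> x xb"
    and stepsize_nonneg: "\<And>k. 0 \<le> \<gamma> k"
    and stepsize_le_one: "\<And>k. \<gamma> k \<le> 1"
    and stepsize_tendsto_zero: "\<gamma> \<longlonglongrightarrow> 0"
    and stepsize_divergent: "filterlim (\<lambda>n. \<Sum>k<n. \<gamma> k) at_top sequentially"
begin

definition objective :: "'a \<Rightarrow> real" where
  "objective z = f z + h z"

definition gap :: "'a \<Rightarrow> 'a \<Rightarrow> real" where
  "gap a b = f' a (a - b) + h a - h b"

lemma subproblem_solution_in: "xb k \<in> C"
  using iteration by (simp add: generalized_frank_wolfe_def is_arg_min_def)

lemma iterate_Suc: "x (Suc k) = x k + \<gamma> k *\<^sub>R (xb k - x k)"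
  using iteration by (simp add: generalized_frank_wolfe_def)

lemma iterate_in: "x k \<in> C"
proof (induction k)
  case 0
  show ?case
    using iteration by (simp add: generalized_frank_wolfe_def)
next
  case (Suc k)
  then have "(1 - \<gamma> k) *\<^sub>R x k + \<gamma> k *\<^sub>R xb k \<in> C"
    using convex_f subproblem_solution_in stepsize_nonneg stepsize_le_one
    by (intro convexD_alt convex_on_imp_convex)
  then show ?case
    by (simp add: iterate_Suc algebra_simps)
qed

lemma gap_le_gap_subproblem_solution:
  assumes "z \<in> C"
  shows "gap (x k) z \<le> gap (x k) (xb k)"
proof -
  have "f' (x k) (xb k) + h (xb k) \<le> f' (x k) z + h z"
    using iteration assms by (auto simp: generalized_frank_wolfe_def is_arg_min_def not_less)
  then show ?thesis
    by (simp add: gap_def blinfun.diff_right)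
qed

lemma suboptimality_le_gap:
  assumes "a \<in> C" and "z \<in> C"
  shows "objective a - objective z \<le> gap a z"
  using convex_on_imp_above_tangent_frechet[OF convex_f derivative[OF assms(1)] assms]
  by (simp add: objective_def gap_def blinfun.diff_right)

lemma objective_step_le:
  assumes "a \<in> C" and "b \<in> C" and "0 \<le> t" and "t \<le> 1"
  shows "objective (a + t *\<^sub>R (b - a))
    \<le> objective a - t * gap a b + (f (a + t *\<^sub>R (b - a)) - f a - f' a (t *\<^sub>R (b - a)))"
proof -
  have "h (a + t *\<^sub>R (b - a)) \<le> (1 - t) * h a + t * h b"
    using convex_onD[OF convex_h assms(3,4,1,2)] by (simp add: algebra_simps)
  then show ?thesis
    by (simp add: objective_def gap_def blinfun.diff_right blinfun.scaleR_right algebra_simps)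
qed

lemma eventually_linearization_error_le:
  assumes "0 < \<epsilon>"
  shows "\<forall>\<^sub>F k in sequentially.
    f (x (Suc k)) - f (x k) - f' (x k) (\<gamma> k *\<^sub>R (xb k - x k)) \<le> \<gamma> k * \<epsilon>"
proof -
  define D where "D = diameter C + 1"
  have "0 < D"
    using diameter_ge_0[OF bounded_C] by (simp add: D_def)
  have displacement: "norm (x (Suc k) - x k) \<le> \<gamma> k * D" for k
    using diameter_bounded_bound[OF bounded_C subproblem_solution_in iterate_in, of k k]
      stepsize_nonneg[of k]
    by (simp add: iterate_Suc D_def dist_norm mult_left_mono)
  obtain \<delta> where "0 < \<delta>"
    and linearization: "\<And>a b. \<lbrakk>a \<in> C; b \<in> C; dist a b < \<delta>\<rbrakk> \<Longrightarrow>
      norm (f b - f a - f' a (b - a)) \<le> \<epsilon> / D * norm (b - a)"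
    using uniformly_continuous_derivative_linearization[OF convex_on_imp_convex[OF convex_f]
        uniformly_continuous_derivative derivative divide_pos_pos[OF \<open>0 < \<epsilon>\<close> \<open>0 < D\<close>]]
    by blast
  have "\<forall>\<^sub>F k in sequentially. \<gamma> k < \<delta> / D"
    using \<open>0 < \<delta>\<close> \<open>0 < D\<close> by (intro order_tendstoD(2)[OF stepsize_tendsto_zero]) simp
  then show ?thesis
  proof eventually_elim
    fix k assume "\<gamma> k < \<delta> / D"
    then have "\<gamma> k * D < \<delta>"
      using \<open>0 < D\<close> by (simp add: field_simps)
    with displacement[of k] have "dist (x k) (x (Suc k)) < \<delta>"
      by (simp add: dist_norm norm_minus_commute)
    then have "norm (f (x (Suc k)) - f (x k) - f' (x k) (x (Suc k) - x k))
        \<le> \<epsilon> / D * norm (x (Suc k) - x k)"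
      by (intro linearization iterate_in)
    also have "\<dots> \<le> \<epsilon> / D * (\<gamma> k * D)"
      using displacement \<open>0 < \<epsilon>\<close> \<open>0 < D\<close> by (intro mult_left_mono) auto
    also have "\<dots> = \<gamma> k * \<epsilon>"
      using \<open>0 < D\<close> by simp
    finally show "f (x (Suc k)) - f (x k) - f' (x k) (\<gamma> k *\<^sub>R (xb k - x k)) \<le> \<gamma> k * \<epsilon>"
      by (simp add: iterate_Suc)
  qed
qed

lemma eventually_objective_contraction:
  assumes "z \<in> C" and "0 < \<epsilon>"
  shows "\<forall>\<^sub>F k in sequentially.
    objective (x (Suc k)) \<le> (1 - \<gamma> k) * objective (x k) + \<gamma> k * (objective z + \<epsilon>)"
  using eventually_linearization_error_le[OF \<open>0 < \<epsilon>\<close>]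
proof eventually_elim
  fix k
  assume error: "f (x (Suc k)) - f (x k) - f' (x k) (\<gamma> k *\<^sub>R (xb k - x k)) \<le> \<gamma> k * \<epsilon>"
  have "objective (x k) - objective z \<le> gap (x k) (xb k)"
    using suboptimality_le_gap[OF iterate_in \<open>z \<in> C\<close>] gap_le_gap_subproblem_solution[OF \<open>z \<in> C\<close>]
    by (rule order_trans)
  then have "\<gamma> k * (objective (x k) - objective z) \<le> \<gamma> k * gap (x k) (xb k)"
    using stepsize_nonneg by (rule mult_left_mono)
  moreover have "objective (x (Suc k)) \<le> objective (x k) - \<gamma> k * gap (x k) (xb k) + \<gamma> k * \<epsilon>"
    using objective_step_le[OF iterate_in subproblem_solution_in stepsize_nonneg stepsize_le_one,
        of k k k] error
    by (simp add: iterate_Suc)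
  ultimately show "objective (x (Suc k))
      \<le> (1 - \<gamma> k) * objective (x k) + \<gamma> k * (objective z + \<epsilon>)"
    by (simp add: algebra_simps)
qed

lemma eventually_objective_less:
  assumes "z \<in> C" and "objective z < d"
  shows "\<forall>\<^sub>F k in sequentially. objective (x k) < d"
proof -
  obtain c where "objective z < c" "c < d"
    using dense[OF assms(2)] by blast
  then have "\<forall>\<^sub>F k in sequentially.
      objective (x (Suc k)) \<le> (1 - \<gamma> k) * objective (x k) + \<gamma> k * c"
    using eventually_objective_contraction[OF assms(1), of "c - objective z"] by simp
  with stepsize_le_one stepsize_divergent show ?thesis
    using \<open>c < d\<close> by (rule eventually_less_if_affine_contraction)
qed

theorem objective_tendsto_INF: "(\<lambda>k. ereal (objective (x k))) \<longlonglongrightarrow> (INF z\<in>C. ereal (objective z))"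
proof (rule order_tendstoI)
  fix l assume "l < (INF z\<in>C. ereal (objective z))"
  then show "\<forall>\<^sub>F k in sequentially. l < ereal (objective (x k))"
    using iterate_in by (auto intro!: always_eventually dest: less_INF_D)
next
  fix u assume "(INF z\<in>C. ereal (objective z)) < u"
  then obtain z where "z \<in> C" and "ereal (objective z) < u"
    by (auto simp: INF_less_iff)
  then obtain d where "objective z < d" and "ereal d < u"
    using ereal_dense2[of "ereal (objective z)" u] by auto
  have "\<forall>\<^sub>F k in sequentially. objective (x k) < d"
    using \<open>z \<in> C\<close> \<open>objective z < d\<close> by (rule eventually_objective_less)
  then show "\<forall>\<^sub>F k in sequentially. ereal (objective (x k)) < u"
    by eventually_elim (rule less_trans[OF _ \<open>ereal d < u\<close>], simp)
qed

end

theorem theorem5p2: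
  fixes C :: "'a::banach set"
    and f :: "'a \<Rightarrow> real"
    and f' :: "'a \<Rightarrow> 'a \<Rightarrow>\<^sub>L real"
    and g :: "'a \<Rightarrow> ereal"
    and \<phi> :: "'a \<Rightarrow> ereal"
    and \<gamma> :: "nat \<Rightarrow> real"
    and x xb :: "nat \<Rightarrow> 'a"
  assumes "C \<noteq> {}" and "closed C" and "bounded C" and "convex C"
    and "convex_on UNIV f"
    and "\<And>z. (f has_derivative blinfun_apply (f' z)) (at z)"
    and "continuous_on UNIV f'"
    and "proper_fun g" and "lsc_fun g" and "convex_fun g"
    and "C \<subseteq> {z. g z < \<infinity>}"
    and "\<phi> = (\<lambda>z. ereal (f z) + g z)"
    and "\<exists>z. is_arg_min \<phi> (\<lambda>y. y \<in> C) z"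
    and "generalized_frank_wolfe C f' g \<gamma> x xb"
    and "uniformly_continuous_on C f'"
    and "\<And>k. 0 < \<gamma> k \<and> \<gamma> k \<le> 1"
    and "\<gamma> \<longlonglongrightarrow> 0"
    and "filterlim (\<lambda>n. \<Sum>k<n. \<gamma> k) at_top sequentially"
  shows "(\<lambda>k. \<phi> (x k)) \<longlonglongrightarrow> (INF z\<in>C. \<phi> z)"
proof -
  define h where "h z = real_of_ereal (g z)" for z
  have g_finite: "\<bar>g z\<bar> \<noteq> \<infinity>" if "z \<in> C" for z
    using that \<open>C \<subseteq> {z. g z < \<infinity>}\<close> \<open>proper_fun g\<close> by (auto simp: proper_fun_def)
  then have g_eq: "g z = ereal (h z)" if "z \<in> C" for z
    using that by (simp add: h_def ereal_real')
  interpret real_frank_wolfe C f f' h \<gamma> x xb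
  proof
    show "convex_on C f"
      using \<open>convex_on UNIV f\<close> \<open>convex C\<close> by (rule convex_on_subset[OF _ subset_UNIV])
    show "convex_on C h"
      unfolding h_def using \<open>convex_fun g\<close> \<open>convex C\<close> g_finite by (rule convex_on_real_of_ereal)
    show "(f has_derivative f' z) (at z within C)" for z
      using assms(6) by (rule has_derivative_at_withinI)
    show "generalized_frank_wolfe C f' (\<lambda>z. ereal (h z)) \<gamma> x xb"
      using \<open>generalized_frank_wolfe C f' g \<gamma> x xb\<close> g_eq generalized_frank_wolfe_cong by metis
  qed (use assms in \<open>auto intro: less_imp_le\<close>)
  have "\<phi> z = ereal (objective z)" if "z \<in> C" for z
    using g_eq[OF that] by (simp add: \<open>\<phi> = _\<close> objective_def)
  with objective_tendsto_INF iterate_in show ?thesis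
    by simp
qed

end
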